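(* Let $q$ be a prime power and $n\geq 1$. Let $L(x)\in\mathbb{F}_q[x]$ be a nonzero $q$-polynomial of degree $q^n$ with $q^n$ distinct roots (in an algebraic closure of $\mathbb{F}_q$), and suppose \[ L(x)=\underbrace{L_1\otimes\cdots\otimes L_1}_{e_1}\otimes\cdots\otimes\underbrace{L_r\otimes\cdots\otimes L_r}_{e_r} \] is a symbolic factorization of $L$, where $e_i\geq1$, the $L_i(x)\in\mathbb{F}_q[x]$ are $q$-polynomials (not necessarily symbolically irreducible) whose conventional $q$-associates $l_i(x)$ are pairwise relatively prime, and $\deg L_i=q^{n_i}$ (so $\deg l_i=n_i$). For $1\leq i\leq r$, let $K_i(x)$ be the $q$-polynomial obtained from this symbolic factorization by omitting one symbolic factor $L_i(x)$, and let $S_{\mathfrak F}(L)$ be the set of roots of $L(x)$ that are roots of none of $K_1,\dots,K_r$. Let $l(x)=l_1(x)^{e_1}\cdots l_r(x)^{e_r}$ be the conventional $q$-associate of $L$ (factorization $\mathfrak f$), let $S_{\mathfrak f}(l)$ be the set of polynomials in $\mathbb{F}_q[x]$ of degree less than $\deg l$ that are divisible by none of $l_1,\dots,l_r$, and set $\Phi_{\mathfrak f}(l)=|S_{\mathfrak f}(l)|$. Then: (i) $|S_{\mathfrak F}(L)|=\Phi_{\mathfrak f}(l)$. (ii) If $l_1(x)=g(x)h(x)$ with $g,h\in\mathbb{F}_q[x]$ relatively prime, $\deg g\geq1$ and $\deg h\geq1$, and $\mathfrak f'$ denotes the factorization $l(x)=g(x)^{e_1}h(x)^{e_1}l_2(x)^{e_2}\cdots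 l_r(x)^{e_r}$ (with $\Phi_{\mathfrak f'}(l)$ defined analogously as the number of polynomials of degree less than $\deg l$ divisible by none of $g,h,l_2,\dots,l_r$), then $\Phi_{\mathfrak f'}(l)<\Phi_{\mathfrak f}(l)$. In particular, $\Phi(l)\leq\Phi_{\mathfrak f}(l)$, where $\Phi(l)$ is the number of polynomials in $\mathbb{F}_q[x]$ of degree less than $\deg l$ that are relatively prime to $l$.
   Context: A $q$-polynomial over $\mathbb{F}_q$ is a polynomial of the form $L(x)=\sum_{i=0}^{k}c_ix^{q^i}$ with $c_i\in\mathbb{F}_q$; its conventional $q$-associate is $l(x)=\sum_{i=0}^{k}c_ix^{i}$. Symbolic multiplication is composition: $L_1(x)\otimes L_2(x)=L_1(L_2(x))$; a symbolic factorization is a factorization with respect to $\otimes$. The conventional $q$-associate of $L_1\otimes L_2$ is $l_1l_2$, so symbolic multiplication of $q$-polynomials over $\mathbb{F}_q$ is commutative.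
   Formalization: Part (ii), including Φ(l) ≤ Φ_f(l), is stated under the added assumption that all n_i ≥ 1 (no l_i is constant); if some l_i is a nonzero constant, it divides everything, so Φ_f(l) = 0 and both inequalities fail. *)

theory Defs
  imports "HOL-Algebra.Algebraic_Closure_Type" "HOL-Library.Cardinality"
begin

hide_const (open) Polynomials.degree up_ring.monom up_ring.coeff

text \<open>
  The field \<open>\<F>\<^sub>q\<close> is a type \<open>'a\<close> of class \<^class>\<open>finite_field\<close>, and \<open>q = CARD('a)\<close>.
\<close>

definition q_polynomial :: "'a::finite_field poly \<Rightarrow> bool" where
  "q_polynomial P \<longleftrightarrow> (\<exists>k c. P = (\<Sum>i\<le>k. monom (c i) (CARD('a) ^ i)))"

text \<open>
  The bound \<open>degree P\<close> is large enough to catch every coefficient, since \<open>i < CARD('a) ^ i\<close>;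
  see \<open>q_associate_sum_monom\<close> below.
\<close>

definition q_associate :: "'a::finite_field poly \<Rightarrow> 'a poly" where
  "q_associate P = (\<Sum>i\<le>degree P. monom (coeff P (CARD('a) ^ i)) i)"

lemma q_associate_sum_monom:
  fixes c :: "nat \<Rightarrow> 'a::finite_field"
  shows "q_associate (\<Sum>i\<le>k. monom (c i) (CARD('a) ^ i)) = (\<Sum>i\<le>k. monom (c i) i)"
    (is "q_associate ?P = ?p")
proof (rule poly_eqI)
  fix j
  have "card {0, 1 :: 'a} \<le> CARD('a)"
    by (rule card_mono) auto
  hence q: "CARD('a) > 1"
    by simp
  have P: "coeff ?P (CARD('a) ^ j) = (if j \<le> k then c j else 0)" for j
    using q by (simp add: coeff_sum)
  have p: "coeff ?p j = (if j \<le> k then c j else 0)"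
    by (simp add: coeff_sum)
  have "coeff (q_associate ?P) j = (if j \<le> degree ?P then coeff ?P (CARD('a) ^ j) else 0)"
    by (simp add: q_associate_def coeff_sum)
  also have "\<dots> = coeff ?P (CARD('a) ^ j)"
  proof (cases "j \<le> degree ?P")
    case False
    moreover have "j < CARD('a) ^ j"
      by (rule less_le_trans[OF less_exp power_mono]) (use q in auto)
    ultimately have "coeff ?P (CARD('a) ^ j) = 0"
      by (intro coeff_eq_0) linarith
    thus ?thesis
      using False by simp
  qed simp
  finally show "coeff (q_associate ?P) j = coeff ?p j"
    by (simp add: P p)
qed

text \<open>
  A factorization, symbolic or conventional, is a list of pairs (factor, multiplicity).
  The neutral element of symbolic multiplication is the polynomial \<open>x\<close>.
\<close>

definition sym_prod :: "('a::finite_field poly \<times> nat) list \<Rightarrow> 'a poly" where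
  "sym_prod F = foldr (\<lambda>(P, k). pcompose P ^^ k) F [:0, 1:]"

definition conv_prod :: "('a::finite_field poly \<times> nat) list \<Rightarrow> 'a poly" where
  "conv_prod f = (\<Prod>(p, k)\<leftarrow>f. p ^ k)"

definition omit_factor :: "('a poly \<times> nat) list \<Rightarrow> nat \<Rightarrow> ('a poly \<times> nat) list" where
  "omit_factor F i = F[i := (fst (F ! i), snd (F ! i) - 1)]"

definition ac_roots :: "'a::field poly \<Rightarrow> 'a alg_closure set" where
  "ac_roots P = {x. poly (map_poly to_ac P) x = 0}"

definition S_sym :: "('a::finite_field poly \<times> nat) list \<Rightarrow> 'a alg_closure set" where
  "S_sym F = {x \<in> ac_roots (sym_prod F).
                \<forall>i<length F. x \<notin> ac_roots (sym_prod (omit_factor F i))}"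

text \<open>
  Below, \<open>degree 0 = 0\<close> does no harm: for a product of positive degree, the zero polynomial
  is among the polynomials of smaller degree, as it should be.
\<close>

definition S_conv :: "('a::finite_field poly \<times> nat) list \<Rightarrow> 'a poly set" where
  "S_conv f = {u. degree u < degree (conv_prod f) \<and> (\<forall>(p, k)\<in>set f. \<not> p dvd u)}"

definition Phi_conv :: "('a::finite_field poly \<times> nat) list \<Rightarrow> nat" where
  "Phi_conv f = card (S_conv f)"

definition Phi :: "'a::finite_field poly \<Rightarrow> nat" where
  "Phi l = card {u. degree u < degree l \<and> coprime u l}"

end

theory Submission
  imports Defs
begin

text \<open>
  A polynomial over \<open>\<F>\<^sub>q\<close> acts on the algebraic closure with \<open>x\<close> acting as the \<open>q\<close>-Frobenius map,
  and the roots of a \<open>q\<close>-polynomial are the kernel of its associate. If \<open>l\<close> has \<open>q ^ deg l\<close> roots in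
  this sense, then every divisor \<open>m\<close> of \<open>l\<close> has \<open>q ^ deg m\<close>. For a set \<open>J\<close> of indices, the common roots of
  the \<open>K\<^sub>j\<close> with \<open>j \<in> J\<close> are by Bezout the kernel of \<open>l\<close> divided by the product of the \<open>l\<^sub>j\<close>, and
  their number equals that of the polynomials of degree less than \<open>deg l\<close> divisible by all these
  \<open>l\<^sub>j\<close>. So (i) follows by inclusion-exclusion, without a cyclic generator of the root space.
\<close>

section \<open>The Frobenius map of a finite field\<close>

lemma CARD_gt_1: "CARD('a::finite_field) > 1"
proof -
  have "card {0, 1 :: 'a} \<le> CARD('a)"
    by (rule card_mono) auto
  thus ?thesis
    by simp
qed

text \<open>
  The polynomial \<open>(X + 1)^q - X^q - 1\<close> has degree less than \<open>q\<close> and vanishes on all of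
  \<open>\<F>\<^sub>q\<close>, so it is zero; this avoids having to know that \<open>q\<close> is a power of the characteristic.
\<close>
lemma CHAR_dvd_CARD_choose:
  assumes "0 < i" "i < CARD('a::finite_field)"
  shows "CHAR('a) dvd (CARD('a) choose i)"
proof -
  define q where "q = CARD('a)"
  define P :: "'a poly" where "P = [:1, 1:] ^ q - monom 1 q - 1"
  have q: "q > 1"
    unfolding q_def by (rule CARD_gt_1)
  have c: "coeff ([:1, 1:] ^ q :: 'a poly) j = of_nat (q choose j)" for j
  proof (cases "j \<le> q")
    case False
    thus ?thesis
      by (simp add: coeff_eq_0 degree_power_eq binomial_eq_0)
  qed (simp add: coeff_linear_poly_power)
  have coeff_P: "coeff P j = of_nat (q choose j) - (if j = q then 1 else 0) - (if j = 0 then 1 else 0)" for j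
    by (simp add: P_def c)
  have roots: "poly P x = 0" for x
    using finite_field_power_card_eq_same[of "1 + x"] finite_field_power_card_eq_same[of x]
    by (simp add: P_def poly_monom q_def)
  have "degree P \<le> q - 1"
    by (rule degree_le) (use q in \<open>auto simp: coeff_P binomial_eq_0\<close>)
  have "P = 0"
  proof (rule ccontr)
    assume "P \<noteq> 0"
    hence "card {x. poly P x = 0} \<le> degree P"
      by (rule card_poly_roots_bound)
    with \<open>degree P \<le> q - 1\<close> q show False
      by (simp add: roots q_def)
  qed
  hence "of_nat (q choose i) = (0 :: 'a)"
    using coeff_P[of i] assms by (simp add: q_def)
  thus ?thesis
    by (simp add: of_nat_eq_0_iff_char_dvd q_def)
qed

text \<open>All middle binomial coefficients vanish. The ring is arbitrary up to its characteristic
  because additivity is needed both for polynomials over the field and in its algebraic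
  closure.\<close>

lemma power_CARD_add:
  fixes x y :: "'b::comm_ring_1"
  assumes "CHAR('b) = CHAR('a::finite_field)"
  shows "(x + y) ^ CARD('a) = x ^ CARD('a) + y ^ CARD('a)"
proof -
  define q where "q = CARD('a)"
  have q: "q > 1"
    unfolding q_def by (rule CARD_gt_1)
  have "(x + y) ^ q = (\<Sum>k\<le>q. of_nat (q choose k) * x ^ k * y ^ (q - k))"
    by (rule binomial_ring)
  also have "\<dots> = (\<Sum>k\<in>{0, q}. of_nat (q choose k) * x ^ k * y ^ (q - k))"
  proof (intro sum.mono_neutral_right ballI)
    fix k assume k: "k \<in> {..q} - {0, q}"
    have "CHAR('b) dvd (q choose k)"
      unfolding assms q_def by (rule CHAR_dvd_CARD_choose) (use k in \<open>auto simp: q_def\<close>)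
    hence "of_nat (q choose k) = (0 :: 'b)"
      using of_nat_eq_0_iff_char_dvd by blast
    thus "of_nat (q choose k) * x ^ k * y ^ (q - k) = 0"
      by simp
  qed auto
  finally show ?thesis
    using q by (simp add: q_def add_ac)
qed

lemma power_CARD_sum:
  fixes f :: "'c \<Rightarrow> 'b::comm_ring_1"
  assumes "CHAR('b) = CHAR('a::finite_field)"
  shows "sum f A ^ CARD('a) = (\<Sum>i\<in>A. f i ^ CARD('a))"
  by (induction A rule: infinite_finite_induct)
     (use CARD_gt_1[where ?'a = 'a] in \<open>simp_all add: power_CARD_add[OF assms] power_0_left\<close>)

lemma power_CARD_diff:
  fixes x y :: "'b::comm_ring_1"
  assumes "CHAR('b) = CHAR('a::finite_field)"
  shows "(x - y) ^ CARD('a) = x ^ CARD('a) - y ^ CARD('a)"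
  using power_CARD_add[OF assms, of "x - y" y] by (simp add: algebra_simps)

section \<open>Linearized polynomials\<close>

text \<open>The inverse of \<open>q_associate\<close> on q-polynomials; it carries the symbolic side
  back to ordinary polynomial algebra.\<close>

definition linearized :: "'a::finite_field poly \<Rightarrow> 'a poly" where
  "linearized p = (\<Sum>i\<le>degree p. monom (coeff p i) (CARD('a) ^ i))"

lemma linearized_eq_sum:
  fixes p :: "'a::finite_field poly"
  assumes "degree p \<le> k"
  shows "linearized p = (\<Sum>i\<le>k. monom (coeff p i) (CARD('a) ^ i))"
  unfolding linearized_def
  by (rule sum.mono_neutral_left) (use assms in \<open>auto simp: coeff_eq_0\<close>)

lemma q_associate_linearized [simp]: "q_associate (linearized p) = p"
  unfolding linearized_def q_associate_sum_monom by (rule poly_as_sum_of_monoms)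

lemma linearized_q_associate:
  assumes "q_polynomial P"
  shows "linearized (q_associate P) = P"
proof -
  from assms obtain k c where P: "P = (\<Sum>i\<le>k. monom (c i) (CARD('a) ^ i))"
    unfolding q_polynomial_def by blast
  define p where "p = (\<Sum>i\<le>k. monom (c i) i)"
  have "degree p \<le> k"
    unfolding p_def by (rule degree_sum_le) (auto intro: order.trans[OF degree_monom_le])
  moreover have "coeff p i = c i" if "i \<le> k" for i
    using that by (simp add: p_def coeff_sum)
  ultimately have "linearized p = P"
    by (simp add: linearized_eq_sum P)
  thus ?thesis
    by (simp add: P p_def q_associate_sum_monom)
qed

text \<open>Since \<open>q > 1\<close>, distinct \<open>i\<close> give distinct exponents
  \<open>q ^ i\<close>, so no two monomials merge.\<close>

lemma coeff_linearized: "coeff (linearized p) (CARD('a) ^ i) = coeff (p :: 'a::finite_field poly) i"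
  using CARD_gt_1[where ?'a = 'a] by (simp add: linearized_def coeff_sum coeff_eq_0)

lemma linearized_0 [simp]: "linearized 0 = 0"
  by (simp add: linearized_def)

lemma linearized_eq_0_iff [simp]: "linearized p = 0 \<longleftrightarrow> p = 0"
  by (metis linearized_0 q_associate_linearized)

lemma degree_linearized:
  fixes p :: "'a::finite_field poly"
  assumes "p \<noteq> 0"
  shows "degree (linearized p) = CARD('a) ^ degree p"
proof (rule antisym)
  show "degree (linearized p) \<le> CARD('a) ^ degree p"
    unfolding linearized_def
    by (rule degree_sum_le)
       (use CARD_gt_1[where ?'a = 'a] in \<open>auto intro!: order.trans[OF degree_monom_le] power_increasing\<close>)
  show "CARD('a) ^ degree p \<le> degree (linearized p)"
    by (rule le_degree) (use assms in \<open>simp add: coeff_linearized\<close>)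
qed

text \<open>A Horner rule: the q-th power is additive, fixes coefficients in the field and
  multiplies exponents by \<open>q\<close>, so it mirrors multiplication by the variable. The
  inductions below run on this rule.\<close>

lemma linearized_pCons:
  "linearized (pCons a p) = [:0, a:] + linearized (p :: 'a::finite_field poly) ^ CARD('a)"
proof -
  have "linearized (pCons a p) = (\<Sum>i\<le>Suc (degree p). monom (coeff (pCons a p) i) (CARD('a) ^ i))"
    by (rule linearized_eq_sum) (simp add: degree_pCons_le)
  also have "\<dots> = monom a 1 + (\<Sum>i\<le>degree p. monom (coeff p i) (CARD('a) ^ Suc i))"
    by (subst sum.atMost_Suc_shift) simp
  also have "(\<Sum>i\<le>degree p. monom (coeff p i) (CARD('a) ^ Suc i)) = linearized p ^ CARD('a)"
    unfolding linearized_def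
    by (subst power_CARD_sum) (simp_all add: monom_power finite_field_power_card_eq_same mult.commute)
  finally show ?thesis
    by (simp add: monom_Suc monom_0)
qed

lemma linearized_1: "linearized 1 = [:0, 1:]"
  using CARD_gt_1[where ?'a = 'a]
  by (simp add: one_pCons linearized_pCons power_0_left del: pCons_one)

lemma linearized_add: "linearized (p + s) = linearized p + linearized (s :: 'a::finite_field poly)"
  by (induction p s rule: poly_induct2) (simp_all add: linearized_pCons power_CARD_add)

lemma linearized_smult: "linearized (smult a p) = smult a (linearized (p :: 'a::finite_field poly))"
  by (induction p)
     (simp_all add: linearized_pCons smult_add_right smult_power finite_field_power_card_eq_same)

text \<open>Composition is a ring homomorphism in its outer argument, so it respects both operations
  in the Horner rule for \<open>p\<close>.\<close>

lemma linearized_mult: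
  "linearized (p * s) = pcompose (linearized p) (linearized (s :: 'a::finite_field poly))"
proof (induction p)
  case (pCons a p)
  have pow: "pcompose (P ^ k) S = pcompose P S ^ k" for P S :: "'a poly" and k
    by (induction k) (simp_all add: pcompose_mult pcompose_1)
  show ?case
    using pCons.IH
    by (simp add: linearized_pCons linearized_add linearized_smult pcompose_add pow pcompose_pCons)
qed simp

lemma sym_prod_linearized:
  "sym_prod (map (map_prod linearized id) f) = linearized (conv_prod f)"
proof (induction f)
  case Nil
  show ?case
    by (simp add: sym_prod_def conv_prod_def linearized_1)
next
  case (Cons x f)
  obtain p k where x: "x = (p, k)"
    by force
  have "(pcompose (linearized p) ^^ k) (linearized s) = linearized (p ^ k * s)" for s
    by (induction k) (simp_all add: linearized_mult mult.assoc)
  thus ?case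
    using Cons.IH by (simp add: x sym_prod_def conv_prod_def)
qed

section \<open>The action of polynomials on the algebraic closure\<close>

lemma poly_map_poly_to_ac_add:
  "poly (map_poly to_ac (P + S)) z = poly (map_poly to_ac P) z + poly (map_poly to_ac S) z"
proof -
  have "map_poly to_ac (P + S) = map_poly to_ac P + map_poly to_ac S"
    by (rule poly_eqI) (simp add: coeff_map_poly)
  thus ?thesis
    by simp
qed

lemma poly_map_poly_to_ac_mult:
  "poly (map_poly to_ac (P * S)) z = poly (map_poly to_ac P) z * poly (map_poly to_ac S) z"
proof -
  have "map_poly to_ac (P * S) = map_poly to_ac P * map_poly to_ac S"
    by (rule poly_eqI) (simp add: coeff_map_poly coeff_mult to_ac_sum)
  thus ?thesis
    by simp
qed

lemma poly_map_poly_to_ac_power: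
  "poly (map_poly to_ac (P ^ k)) z = poly (map_poly to_ac P) z ^ k"
  by (induction k) (simp_all add: poly_map_poly_to_ac_mult)

lemma poly_map_poly_to_ac_pcompose:
  "poly (map_poly to_ac (pcompose P S)) z = poly (map_poly to_ac P) (poly (map_poly to_ac S) z)"
  by (induction P)
     (simp_all add: pcompose_pCons poly_map_poly_to_ac_add poly_map_poly_to_ac_mult map_poly_pCons)

text \<open>This is \<open>p\<close> evaluated at the Frobenius endomorphism; it makes the closure a
  module over the polynomial ring.\<close>

definition frob_act :: "'a::finite_field poly \<Rightarrow> 'a alg_closure \<Rightarrow> 'a alg_closure" where
  "frob_act p z = poly (map_poly to_ac (linearized p)) z"

lemma ac_roots_linearized: "ac_roots (linearized p) = {z. frob_act p z = 0}"
  by (simp add: ac_roots_def frob_act_def)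

lemma frob_act_0 [simp]: "frob_act 0 z = 0"
  by (simp add: frob_act_def)

lemma frob_act_pCons:
  "frob_act (pCons a p) z = to_ac a * z + frob_act (p :: 'a::finite_field poly) z ^ CARD('a)"
  by (simp add: frob_act_def linearized_pCons poly_map_poly_to_ac_add poly_map_poly_to_ac_power
        map_poly_pCons)

lemma frob_act_add: "frob_act (p + s) z = frob_act p z + frob_act s z"
  by (simp add: frob_act_def linearized_add poly_map_poly_to_ac_add)

lemma frob_act_mult: "frob_act (p * s) z = frob_act p (frob_act s z)"
  by (simp add: frob_act_def linearized_mult poly_map_poly_to_ac_pcompose)

lemma frob_act_diff_right:
  "frob_act (p :: 'a::finite_field poly) (x - y) = frob_act p x - frob_act p y"
  by (induction p) (simp_all add: frob_act_pCons power_CARD_diff right_diff_distrib)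

lemma frob_act_zero_right [simp]: "frob_act p 0 = 0"
  using frob_act_diff_right[of p 0 0] by simp

section \<open>Sizes of kernels\<close>

lemma card_ac_roots_linearized_le:
  fixes p :: "'a::finite_field poly"
  assumes "p \<noteq> 0"
  shows "finite (ac_roots (linearized p))"
    and "card (ac_roots (linearized p)) \<le> CARD('a) ^ degree p"
proof -
  have nz: "map_poly to_ac (linearized p) \<noteq> 0"
    using assms by (simp add: map_poly_eq_0_iff)
  show "finite (ac_roots (linearized p))"
    unfolding ac_roots_def by (rule poly_roots_finite[OF nz])
  have "card (ac_roots (linearized p)) \<le> degree (map_poly to_ac (linearized p))"
    unfolding ac_roots_def by (rule card_poly_roots_bound[OF nz])
  also have "\<dots> = CARD('a) ^ degree p"
    using assms by (simp add: degree_map_poly degree_linearized)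
  finally show "card (ac_roots (linearized p)) \<le> CARD('a) ^ degree p" .
qed

lemma card_le_card_image_mult:
  assumes "finite A" "\<And>y. y \<in> f ` A \<Longrightarrow> card {x \<in> A. f x = y} \<le> N"
  shows "card A \<le> card (f ` A) * N"
proof -
  have "A = (\<Union>y\<in>f ` A. {x \<in> A. f x = y})"
    by auto
  hence "card A \<le> (\<Sum>y\<in>f ` A. card {x \<in> A. f x = y})"
    using card_UN_le[of "f ` A" "\<lambda>y. {x \<in> A. f x = y}"] assms(1) by simp
  also have "\<dots> \<le> card (f ` A) * N"
    using sum_bounded_above[of "f ` A" "\<lambda>y. card {x \<in> A. f x = y}" N] assms(2) by simp
  finally show ?thesis .
qed

text \<open>
  \<open>m\<close> maps the roots belonging to \<open>m * s\<close> to roots belonging to \<open>s\<close>, with kernel the roots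
  belonging to \<open>m\<close>. Since both of these are bounded by their degree, both bounds are attained.
\<close>
lemma card_ac_roots_linearized_factor:
  fixes m s :: "'a::finite_field poly"
  assumes "m * s \<noteq> 0"
    and "card (ac_roots (linearized (m * s))) = CARD('a) ^ degree (m * s)"
  shows "card (ac_roots (linearized m)) = CARD('a) ^ degree m"
proof -
  define R where "R p = ac_roots (linearized p)" for p :: "'a poly"
  have nz: "m \<noteq> 0" "s \<noteq> 0"
    using assms by auto
  have fin: "finite (R p)" and le: "card (R p) \<le> CARD('a) ^ degree p" if "p \<noteq> 0" for p
    unfolding R_def using card_ac_roots_linearized_le[OF that] by auto
  \<comment> \<open>Subtracting \<open>x'\<close> moves the fibre through \<open>x'\<close> into the
    kernel of \<open>m\<close>.\<close>
  have fibre: "card {x \<in> R (m * s). frob_act m x = frob_act m x'} \<le> card (R m)" for x'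
  proof (rule card_inj_on_le)
    show "inj_on (\<lambda>x. x - x') {x \<in> R (m * s). frob_act m x = frob_act m x'}"
      by (auto simp: inj_on_def)
    show "(\<lambda>x. x - x') ` {x \<in> R (m * s). frob_act m x = frob_act m x'} \<subseteq> R m"
      by (auto simp: R_def ac_roots_linearized frob_act_diff_right)
  qed (rule fin[OF nz(1)])
  have "frob_act m ` R (m * s) \<subseteq> R s"
    by (auto simp: R_def ac_roots_linearized mult.commute[of m s] simp flip: frob_act_mult)
  hence img: "card (frob_act m ` R (m * s)) \<le> CARD('a) ^ degree s"
    using card_mono[OF fin[OF nz(2)]] le[OF nz(2)] by (meson order.trans)
  \<comment> \<open>The domain is at most the image times the largest fibre; cancelling the bound on
    the image leaves the lower bound for the kernel.\<close>
  have "CARD('a) ^ degree s * CARD('a) ^ degree m = card (R (m * s))"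
    using assms(2) nz by (simp add: R_def degree_mult_eq power_add)
  also have "\<dots> \<le> card (frob_act m ` R (m * s)) * card (R m)"
    by (rule card_le_card_image_mult) (use fin assms(1) fibre in auto)
  also have "\<dots> \<le> CARD('a) ^ degree s * card (R m)"
    using img by simp
  finally have "CARD('a) ^ degree m \<le> card (R m)"
    by simp
  with le[OF nz(1)] show ?thesis
    unfolding R_def by simp
qed

section \<open>Comaximal factors\<close>

text \<open>A nonzero combination of least degree divides every combination, by division with
  remainder; dividing both \<open>p\<close> and \<open>s\<close>, it is a unit.\<close>

lemma coprime_poly_bezout:
  fixes p s :: "'a::field poly"
  assumes "coprime p s"
  obtains u v where "u * p + v * s = 1"
proof -
  have "p \<noteq> 0 \<or> s \<noteq> 0"
    using assms by auto
  define W where "W = {w. w \<noteq> 0 \<and> (\<exists>u v. w = u * p + v * s)}"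
  have "p = 1 * p + 0 * s" "s = 0 * p + 1 * s"
    by simp_all
  hence "\<exists>w. w \<in> W"
    using \<open>p \<noteq> 0 \<or> s \<noteq> 0\<close> unfolding W_def by blast
  then obtain w where w: "w \<in> W" and min: "\<And>w'. w' \<in> W \<Longrightarrow> degree w \<le> degree w'"
    using ex_has_least_nat[of "\<lambda>w. w \<in> W" _ degree] by blast
  from w obtain u v where uv: "w \<noteq> 0" "w = u * p + v * s"
    unfolding W_def by auto
  have dvd: "w dvd a * p + b * s" for a b
  proof (rule ccontr)
    let ?x = "a * p + b * s"
    assume "\<not> w dvd ?x"
    hence nz: "?x mod w \<noteq> 0"
      by (simp add: dvd_eq_mod_eq_0)
    define t where "t = ?x div w"
    have "?x mod w = ?x - t * w"
      by (simp add: t_def minus_div_mult_eq_mod)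
    also have "\<dots> = (a - t * u) * p + (b - t * v) * s"
      by (simp add: uv(2) algebra_simps)
    finally have "?x mod w \<in> W"
      using nz unfolding W_def by blast
    moreover have "degree (?x mod w) < degree w"
      using degree_mod_less[OF uv(1), of ?x] nz by simp
    ultimately show False
      using min by fastforce
  qed
  have "w dvd p" "w dvd s"
    using dvd[of 1 0] dvd[of 0 1] by simp_all
  with assms have "is_unit w"
    by (rule coprime_common_divisor)
  then obtain t where "1 = w * t"
    by (elim dvdE)
  hence "(t * u) * p + (t * v) * s = 1"
    by (simp add: uv(2) algebra_simps)
  thus ?thesis
    by (rule that)
qed

text \<open>Each \<open>f i\<close> is invertible modulo \<open>s\<close>, hence so is their
  product: multiply the identities. An empty or infinite \<open>J\<close> has product 1.\<close>

lemma prod_bezout: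
  fixes f :: "'b \<Rightarrow> 'a::comm_ring_1"
  assumes "\<And>i. i \<in> J \<Longrightarrow> \<exists>u v. u * f i + v * s = 1"
  shows "\<exists>u v. u * prod f J + v * s = 1"
  using assms
proof (induction J rule: infinite_finite_induct)
  case (insert i J)
  then obtain u v u' v' where "u * f i + v * s = 1" "u' * prod f J + v' * s = 1"
    by (metis insertCI)
  hence "(u * f i + v * s) * (u' * prod f J + v' * s) = 1"
    by simp
  hence "(u * u') * (f i * prod f J) + (u * f i * v' + v * u' * prod f J + v * s * v') * s = 1"
    by (simp add: algebra_simps)
  with insert.hyps show ?case
    by auto
qed (rule exI[of _ 1], rule exI[of _ 0], simp)+

text \<open>Multiply the identity by \<open>c\<close>: in each summand one factor is explicit and
  the other divides \<open>c\<close>.\<close>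

lemma mult_dvd_of_bezout:
  fixes a b c :: "'a::comm_ring_1"
  assumes "u * a + v * b = 1" "a dvd c" "b dvd c"
  shows "a * b dvd c"
proof -
  have "c = (u * a + v * b) * c"
    using assms(1) by simp
  also have "\<dots> = u * (a * c) + v * (c * b)"
    by (simp add: algebra_simps)
  also have "a * b dvd \<dots>"
    by (intro dvd_add dvd_mult mult_dvd_mono assms) auto
  finally show ?thesis .
qed

lemma prod_dvd_iff_of_bezout:
  fixes f :: "'b \<Rightarrow> 'a::comm_ring_1"
  assumes "finite J" "\<And>i j. i \<in> J \<Longrightarrow> j \<in> J \<Longrightarrow> i \<noteq> j \<Longrightarrow> \<exists>u v. u * f i + v * f j = 1"
  shows "prod f J dvd c \<longleftrightarrow> (\<forall>j\<in>J. f j dvd c)"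
  using assms
proof (induction J rule: finite_induct)
  case (insert i J)
  have "\<exists>u v. u * prod f J + v * f i = 1"
    by (rule prod_bezout) (use insert in \<open>metis insertCI\<close>)
  hence "prod f J * f i dvd c" if "prod f J dvd c" "f i dvd c"
    using mult_dvd_of_bezout that by blast
  moreover have "prod f J dvd c \<longleftrightarrow> (\<forall>j\<in>J. f j dvd c)"
    using insert by blast
  ultimately show ?case
    using insert.hyps by (auto simp: mult.commute dest: dvd_mult_left dvd_mult_right)
qed simp

section \<open>Counting\<close>

text \<open>Inclusion-exclusion without signed sums: the sizes of all intersections determine the
  size of the complement. The induction removes one set at a time and uses its hypothesis for
  \<open>S\<close> and again for \<open>S \<inter> A i\<close>.\<close>

lemma card_Diff_UN_cong:
  assumes "finite I" "finite S" "finite T"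
    and "\<And>J. J \<subseteq> I \<Longrightarrow> card (S \<inter> (\<Inter>j\<in>J. A j)) = card (T \<inter> (\<Inter>j\<in>J. B j))"
  shows "card (S - (\<Union>i\<in>I. A i)) = card (T - (\<Union>i\<in>I. B i))"
  using assms
proof (induction I arbitrary: S T rule: finite_induct)
  case empty
  show ?case
    using empty.prems(3)[of "{}"] by simp
next
  case (insert i I)
  \<comment> \<open>\<open>Z\<close> has a type of its own because the identity serves both
    \<open>S\<close> and \<open>T\<close>.\<close>
  have split: "card (Z - (\<Union>j\<in>insert i I. C j)) =
      card (Z - (\<Union>j\<in>I. C j)) - card ((Z \<inter> C i) - (\<Union>j\<in>I. C j))" if "finite Z"
    for Z :: "'z set" and C
  proof -
    have "Z - (\<Union>j\<in>insert i I. C j) = (Z - (\<Union>j\<in>I. C j)) - ((Z \<inter> C i) - (\<Union>j\<in>I. C j))"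
      by auto
    also have "card \<dots> = card (Z - (\<Union>j\<in>I. C j)) - card ((Z \<inter> C i) - (\<Union>j\<in>I. C j))"
      by (rule card_Diff_subset) (use that in auto)
    finally show ?thesis .
  qed
  have "card (S - (\<Union>j\<in>I. A j)) = card (T - (\<Union>j\<in>I. B j))"
    by (rule insert.IH) (use insert.prems in auto)
  moreover have "card ((S \<inter> A i) - (\<Union>j\<in>I. A j)) = card ((T \<inter> B i) - (\<Union>j\<in>I. B j))"
  proof (rule insert.IH)
    fix J assume "J \<subseteq> I"
    hence "card (S \<inter> (\<Inter>j\<in>insert i J. A j)) = card (T \<inter> (\<Inter>j\<in>insert i J. B j))"
      by (intro insert.prems) auto
    thus "card (S \<inter> A i \<inter> (\<Inter>j\<in>J. A j)) = card (T \<inter> B i \<inter> (\<Inter>j\<in>J. B j))"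
      by (simp add: Int_assoc)
  qed (use insert.prems in auto)
  ultimately show ?case
    by (simp only: split[OF insert.prems(1)] split[OF insert.prems(2)])
qed

section \<open>Polynomials of bounded degree\<close>

definition polys_below :: "nat \<Rightarrow> 'a::zero poly set" where
  "polys_below N = {u. u = 0 \<or> degree u < N}"

lemma polys_below_Suc: "polys_below (Suc N) = case_prod pCons ` (UNIV \<times> polys_below N)"
proof (intro equalityI subsetI)
  fix u :: "'a poly" assume u: "u \<in> polys_below (Suc N)"
  obtain a p where "u = pCons a p"
    by (rule pCons_cases)
  with u show "u \<in> case_prod pCons ` (UNIV \<times> polys_below N)"
    by (auto simp: polys_below_def split: if_splits)
qed (auto simp: polys_below_def degree_pCons_eq_if split: if_splits)

lemma card_polys_below:
  "finite (polys_below N :: 'a::finite_field poly set) \<and>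
   card (polys_below N :: 'a poly set) = CARD('a) ^ N"
proof (induction N)
  case 0
  have "polys_below 0 = {0 :: 'a poly}"
    by (auto simp: polys_below_def)
  thus ?case
    by simp
next
  case (Suc N)
  have "inj_on (case_prod pCons) (UNIV \<times> (polys_below N :: 'a poly set))"
    by (auto simp: inj_on_def)
  with Suc show ?case
    by (simp add: polys_below_Suc card_image card_cartesian_product)
qed

text \<open>Multiplication by \<open>P\<close> is a bijection from the polynomials below
  \<open>degree m\<close> onto these multiples.\<close>

lemma card_multiples_below:
  fixes P m :: "'a::finite_field poly"
  assumes "P * m \<noteq> 0"
  shows "card {u \<in> polys_below (degree (P * m)). P dvd u} = CARD('a) ^ degree m"
proof -
  have nz: "P \<noteq> 0" "m \<noteq> 0"
    using assms by auto
  have "{u \<in> polys_below (degree (P * m)). P dvd u} = (*) P ` polys_below (degree m)"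
  proof (intro equalityI subsetI)
    fix u assume "u \<in> {u \<in> polys_below (degree (P * m)). P dvd u}"
    then obtain v where "u = P * v" "P * v \<in> polys_below (degree (P * m))"
      by (auto elim: dvdE)
    with nz show "u \<in> (*) P ` polys_below (degree m)"
      by (cases "v = 0") (auto simp: polys_below_def degree_mult_eq)
  next
    fix u assume "u \<in> (*) P ` polys_below (degree m)"
    then obtain v where "u = P * v" "v \<in> polys_below (degree m)"
      by auto
    with nz show "u \<in> {u \<in> polys_below (degree (P * m)). P dvd u}"
      by (cases "v = 0") (auto simp: polys_below_def degree_mult_eq)
  qed
  moreover have "inj_on ((*) P) (polys_below (degree m))"
    using nz by (auto simp: inj_on_def)
  ultimately show ?thesis
    by (simp add: card_image card_polys_below)
qed

section \<open>Matching roots with polynomials\<close>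

text \<open>Here \<open>k j\<close> is \<open>c\<close> with one factor \<open>p j\<close> removed.
  Adding an index \<open>i\<close> intersects the kernels of \<open>p i * m\<close> and
  \<open>prod p J * m\<close>; as \<open>p i\<close> and \<open>prod p J\<close> are comaximal, the
  result is the kernel of \<open>m\<close>.\<close>

lemma ac_roots_linearized_Int:
  fixes c :: "'a::finite_field poly"
  assumes "finite J" "c \<noteq> 0"
    and "\<And>j. j \<in> J \<Longrightarrow> c = p j * k j"
    and "\<And>i j. i \<in> J \<Longrightarrow> j \<in> J \<Longrightarrow> i \<noteq> j \<Longrightarrow> coprime (p i) (p j)"
    and "c = prod p J * m"
  shows "ac_roots (linearized c) \<inter> (\<Inter>j\<in>J. ac_roots (linearized (k j))) = ac_roots (linearized m)"
  using assms
proof (induction J arbitrary: m rule: finite_induct)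
  case empty
  thus ?case
    by simp
next
  case (insert i J)
  have c: "c = prod p J * (p i * m)"
    using insert.prems(4) insert.hyps by (simp add: mult_ac)
  \<comment> \<open>Without the index \<open>i\<close>, the cofactor of the product is
    \<open>p i * m\<close>.\<close>
  have IH: "ac_roots (linearized c) \<inter> (\<Inter>j\<in>J. ac_roots (linearized (k j))) =
      ac_roots (linearized (p i * m))"
    by (rule insert.IH[OF _ _ _ c]) (use insert.prems(1-3) in auto)
  have "p i * k i = prod p J * (p i * m)"
    using insert.prems(2)[of i] by (simp flip: c)
  hence "p i * k i = p i * (prod p J * m)"
    by (simp only: mult_ac)
  moreover have "p i \<noteq> 0"
    using insert.prems(1) c by auto
  ultimately have k: "k i = prod p J * m"
    by simp
  have "\<exists>u v. u * prod p J + v * p i = 1"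
  proof (rule prod_bezout)
    fix j assume "j \<in> J"
    hence "coprime (p j) (p i)"
      using insert.hyps insert.prems(3) by auto
    thus "\<exists>u v. u * p j + v * p i = 1"
      by (meson coprime_poly_bezout)
  qed
  then obtain u v where uv: "u * prod p J + v * p i = 1"
    by blast
  have "frob_act (p i * m) z = 0 \<and> frob_act (k i) z = 0 \<longleftrightarrow> frob_act m z = 0" for z
  proof
    assume *: "frob_act (p i * m) z = 0 \<and> frob_act (k i) z = 0"
    have "m = (u * prod p J + v * p i) * m"
      using uv by simp
    also have "\<dots> = u * k i + v * (p i * m)"
      by (simp add: k algebra_simps)
    also have "frob_act \<dots> z = 0"
      using * by (simp add: frob_act_add frob_act_mult)
    finally show "frob_act m z = 0" .
  qed (simp add: k frob_act_mult)
  hence "ac_roots (linearized (p i * m)) \<inter> ac_roots (linearized (k i)) = ac_roots (linearized m)"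
    by (auto simp: ac_roots_linearized)
  with IH show ?case
    by auto
qed

text \<open>Multiplicity at least 1 keeps the truncated subtraction in \<open>omit_factor\<close>
  exact.\<close>

lemma conv_prod_omit_factor:
  assumes "i < length f" "snd (f ! i) \<ge> 1"
  shows "conv_prod f = fst (f ! i) * conv_prod (omit_factor f i)"
proof -
  obtain p k where pk: "f ! i = (p, Suc k)"
    using assms(2) by (metis One_nat_def Suc_le_D prod.collapse)
  have "f = take i f @ (p, Suc k) # drop (Suc i) f"
    using id_take_nth_drop[OF assms(1)] pk by simp
  moreover have "omit_factor f i = take i f @ (p, k) # drop (Suc i) f"
    using assms(1) pk by (simp add: omit_factor_def upd_conv_take_nth_drop)
  moreover have "conv_prod (take i f @ (p, Suc k) # drop (Suc i) f) =
      p * conv_prod (take i f @ (p, k) # drop (Suc i) f)"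
    by (simp add: conv_prod_def mult_ac)
  ultimately show ?thesis
    by (metis fst_conv pk)
qed

lemma omit_factor_map_linearized:
  assumes "i < length f"
  shows "omit_factor (map (map_prod linearized id) f) i =
    map (map_prod linearized id) (omit_factor f i)"
  using assms by (simp add: omit_factor_def map_update)

text \<open>Both sides count a finite set minus a union indexed by the factors, so it suffices to
  compare the intersections over each \<open>J\<close>.\<close>

lemma card_S_sym_linearized:
  fixes f :: "('a::finite_field poly \<times> nat) list"
  assumes mult: "\<And>i. i < length f \<Longrightarrow> snd (f ! i) \<ge> 1"
    and coprime: "\<And>i j. i < length f \<Longrightarrow> j < length f \<Longrightarrow> i \<noteq> j \<Longrightarrow> coprime (fst (f ! i)) (fst (f ! j))"
    and deg: "degree (conv_prod f) > 0"
    and sep: "card (ac_roots (linearized (conv_prod f))) = CARD('a) ^ degree (conv_prod f)"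
  shows "card (S_sym (map (map_prod linearized id) f)) = Phi_conv f"
proof -
  define c where "c = conv_prod f"
  define I where "I = {..<length f}"
  define p where "p = (\<lambda>i. fst (f ! i))"
  define k where "k = (\<lambda>i. conv_prod (omit_factor f i))"
  have c0: "c \<noteq> 0"
    using deg by (auto simp: c_def)
  have pk: "c = p i * k i" if "i \<in> I" for i
    using that mult by (simp add: c_def I_def p_def k_def conv_prod_omit_factor)
  have cop: "coprime (p i) (p j)" if "i \<in> I" "j \<in> I" "i \<noteq> j" for i j
    using that coprime by (simp add: I_def p_def)
  have "S_sym (map (map_prod linearized id) f) =
      ac_roots (linearized c) - (\<Union>i\<in>I. ac_roots (linearized (k i)))"
    by (auto simp: S_sym_def sym_prod_linearized omit_factor_map_linearized c_def I_def k_def)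
  also have "card \<dots> = card (polys_below (degree c) - (\<Union>i\<in>I. {u. p i dvd u}))"
  proof (rule card_Diff_UN_cong)
    fix J assume J: "J \<subseteq> I"
    have fin: "finite J"
      using J finite_subset by (auto simp: I_def)
    have prod_dvd: "prod p J dvd u \<longleftrightarrow> (\<forall>j\<in>J. p j dvd u)" for u
      by (rule prod_dvd_iff_of_bezout[OF fin]) (meson J subsetD cop coprime_poly_bezout)
    have "prod p J dvd c"
      unfolding prod_dvd using J pk by auto
    \<comment> \<open>The cofactor \<open>m\<close> measures both intersections: the kernel of
      \<open>m\<close> and the set of multiples of \<open>prod p J\<close> each have
      \<open>q ^ degree m\<close> elements.\<close>
    then obtain m where m: "c = prod p J * m"
      by (elim dvdE)
    have "ac_roots (linearized c) \<inter> (\<Inter>j\<in>J. ac_roots (linearized (k j))) = ac_roots (linearized m)"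
      by (rule ac_roots_linearized_Int) (use fin c0 pk cop J m in auto)
    also have "card \<dots> = CARD('a) ^ degree m"
      by (rule card_ac_roots_linearized_factor[of m "prod p J"])
         (use c0 sep m in \<open>simp_all add: mult.commute c_def\<close>)
    also have "\<dots> = card {u \<in> polys_below (degree c). prod p J dvd u}"
      using card_multiples_below[of "prod p J" m] c0 m by simp
    also have "{u \<in> polys_below (degree c). prod p J dvd u} =
        polys_below (degree c) \<inter> (\<Inter>j\<in>J. {u. p j dvd u})"
      by (auto simp: prod_dvd)
    finally show "card (ac_roots (linearized c) \<inter> (\<Inter>j\<in>J. ac_roots (linearized (k j)))) =
        card (polys_below (degree c) \<inter> (\<Inter>j\<in>J. {u. p j dvd u}))" .
  qed (use c0 in \<open>auto simp: I_def card_polys_below card_ac_roots_linearized_le\<close>)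
  \<comment> \<open>As \<open>c\<close> has positive degree, zero also satisfies
    \<open>degree u < degree c\<close>, so the two ways of bounding the degree agree.\<close>
  also have "polys_below (degree c) - (\<Union>i\<in>I. {u. p i dvd u}) = S_conv f"
  proof -
    have "(\<forall>i\<in>I. \<not> p i dvd u) \<longleftrightarrow> (\<forall>(x, y)\<in>set f. \<not> x dvd u)" for u
      by (simp add: I_def p_def case_prod_unfold all_set_conv_all_nth lessThan_def)
    thus ?thesis
      using deg by (auto simp: polys_below_def S_conv_def c_def)
  qed
  finally show ?thesis
    unfolding Phi_conv_def .
qed

section \<open>Refining a factorization\<close>

lemma finite_degree_less: "finite {u :: 'a::finite_field poly. degree u < N \<and> Q u}"
  by (rule finite_subset[of _ "polys_below N"]) (auto simp: card_polys_below, auto simp: polys_below_def)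

lemma not_dvd_of_coprime:
  fixes p u :: "'a::field poly"
  assumes "coprime u l" "p dvd l" "degree p \<ge> 1"
  shows "\<not> p dvd u"
  using coprime_common_divisor[OF assms(1) _ assms(2)] assms(3)
  by (cases "p = 0") (auto simp: is_unit_iff_degree)

text \<open>Every factor is a nonconstant divisor of the product, so it cannot divide a polynomial
  coprime to the product.\<close>

lemma Phi_le_Phi_conv:
  fixes f :: "('a::finite_field poly \<times> nat) list"
  assumes "\<And>p k. (p, k) \<in> set f \<Longrightarrow> k \<ge> 1 \<and> degree p \<ge> 1"
  shows "Phi (conv_prod f) \<le> Phi_conv f"
proof -
  have dvd: "p dvd conv_prod f" if "(p, k) \<in> set f" for p k
  proof -
    have "p dvd p ^ k"
      using assms[OF that] by (simp add: dvd_power)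
    also have "p ^ k dvd conv_prod f"
      unfolding conv_prod_def using that by (intro prod_list_dvd) force
    finally show ?thesis .
  qed
  have "{u. degree u < degree (conv_prod f) \<and> coprime u (conv_prod f)} \<subseteq> S_conv f"
    unfolding S_conv_def using dvd assms not_dvd_of_coprime by blast
  thus ?thesis
    unfolding Phi_def Phi_conv_def
    by (rule card_mono[rotated]) (simp add: S_conv_def finite_degree_less)
qed

text \<open>The factor \<open>g\<close> itself is counted before the refinement but not after it.\<close>
lemma Phi_conv_refine_less:
  fixes f :: "('a::finite_field poly \<times> nat) list"
  assumes nz: "conv_prod ((g * h, k) # f) \<noteq> 0" and "k \<ge> 1" "degree g \<ge> 1" "degree h \<ge> 1"
    and f: "\<And>p j. (p, j) \<in> set f \<Longrightarrow> degree p \<ge> 1 \<and> coprime (g * h) p"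
  shows "Phi_conv ((g, k) # (h, k) # f) < Phi_conv ((g * h, k) # f)"
  unfolding Phi_conv_def
proof (rule psubset_card_mono)
  show "finite (S_conv ((g * h, k) # f))"
    by (simp add: S_conv_def finite_degree_less)
  have eq: "conv_prod ((g, k) # (h, k) # f) = conv_prod ((g * h, k) # f)"
    by (simp add: conv_prod_def power_mult_distrib mult_ac)
  have gh: "g \<noteq> 0" "h \<noteq> 0"
    using assms(3,4) by auto
  have "degree g < degree (g * h)"
    using gh assms(4) by (simp add: degree_mult_eq)
  also have "\<dots> \<le> degree (conv_prod ((g * h, k) # f))"
    using nz assms(2) by (intro dvd_imp_degree_le) (auto simp: conv_prod_def intro: dvd_mult2 dvd_power)
  finally have "degree g < degree (conv_prod ((g * h, k) # f))" .
  moreover have "\<not> g * h dvd g"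
    using gh assms(4) dvd_imp_degree_le[of "g * h" g] by (auto simp: degree_mult_eq)
  \<comment> \<open>A nonconstant \<open>p\<close> coprime to \<open>g * h\<close> does not divide
    \<open>g * h\<close>, hence not its divisor \<open>g\<close>.\<close>
  moreover have "\<not> p dvd g" if "(p, j) \<in> set f" for p j
    using not_dvd_of_coprime[of "g * h" p p] f[OF that] by auto
  ultimately have "g \<in> S_conv ((g * h, k) # f)"
    by (auto simp: S_conv_def)
  moreover have "g \<notin> S_conv ((g, k) # (h, k) # f)"
    by (simp add: S_conv_def)
  moreover have "S_conv ((g, k) # (h, k) # f) \<subseteq> S_conv ((g * h, k) # f)"
    unfolding S_conv_def eq by (auto dest: dvd_mult_left)
  ultimately show "S_conv ((g, k) # (h, k) # f) \<subset> S_conv ((g * h, k) # f)"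
    by blast
qed

section \<open>Transfer to the given symbolic factorization\<close>

theorem theorem3p3:
  fixes L :: "'a::finite_field poly"
    and Lf :: "nat \<Rightarrow> 'a poly"
    and l :: "'a poly"
    and lf :: "nat \<Rightarrow> 'a poly"
    and e d :: "nat \<Rightarrow> nat"
    and q n r :: nat
    and FF ff :: "('a poly \<times> nat) list"
  assumes "q = CARD('a)"
    and "n \<ge> 1"
    and "L \<noteq> 0" and "q_polynomial L" and "degree L = q ^ n"
    and "card (ac_roots L) = q ^ n"
    and "\<forall>i\<in>{1..r}. e i \<ge> 1"
    and "\<forall>i\<in>{1..r}. q_polynomial (Lf i) \<and> degree (Lf i) = q ^ d i"
    and "\<forall>i\<in>{1..r}. lf i = q_associate (Lf i)"
    and "\<forall>i\<in>{1..r}. \<forall>j\<in>{1..r}. i \<noteq> j \<longrightarrow> coprime (lf i) (lf j)"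
    and "FF = map (\<lambda>i. (Lf i, e i)) [1..<Suc r]"
    and "L = sym_prod FF"
    and "l = q_associate L"
    and "ff = map (\<lambda>i. (lf i, e i)) [1..<Suc r]"
  shows "l = conv_prod ff \<and>
         card (S_sym FF) = Phi_conv ff \<and>
         ((\<forall>i\<in>{1..r}. d i \<ge> 1) \<longrightarrow>
            (\<forall>g h. lf 1 = g * h \<and> coprime g h \<and> degree g \<ge> 1 \<and> degree h \<ge> 1 \<longrightarrow>
               Phi_conv ((g, e 1) # (h, e 1) # map (\<lambda>i. (lf i, e i)) [2..<Suc r]) < Phi_conv ff) \<and>
            Phi l \<le> Phi_conv ff)"
proof -
  have q: "q > 1"
    unfolding assms(1) by (rule CARD_gt_1)
  have Lf: "Lf i = linearized (lf i)" if "i \<in> {1..r}" for i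
    using assms(8,9) that by (simp add: linearized_q_associate)
  have FF: "FF = map (map_prod linearized id) ff"
    unfolding assms(11,14) by (auto simp: Lf simp del: upt_Suc)
  have L: "L = linearized (conv_prod ff)"
    unfolding assms(12) FF by (rule sym_prod_linearized)
  have l: "l = conv_prod ff"
    unfolding assms(13) L by simp
  have l0: "l \<noteq> 0"
    using assms(3) L l by simp
  have deg_l: "degree l = n"
    using assms(5) degree_linearized[OF l0] q unfolding L l[symmetric] by (simp flip: assms(1))
  \<comment> \<open>List positions start at 0, the indices of the factors at 1.\<close>
  have nth: "ff ! i = (lf (Suc i), e (Suc i))" if "i < r" for i
    using that by (simp add: assms(14) del: upt_Suc)
  have len: "length ff = r"
    by (simp add: assms(14))
  have "card (S_sym FF) = Phi_conv ff"
    unfolding FF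
  proof (rule card_S_sym_linearized)
    show "card (ac_roots (linearized (conv_prod ff))) = CARD('a) ^ degree (conv_prod ff)"
      using assms(1,6) deg_l by (simp add: L l)
  qed (use assms(2,7,10) deg_l l in \<open>auto simp: len nth\<close>)
  \<comment> \<open>A constant factor \<open>lf i\<close> would be a unit, divide every polynomial
    and empty \<open>S_conv\<close>; hence the restriction to \<open>d i \<ge> 1\<close>.\<close>
  moreover have "(\<forall>g h. lf 1 = g * h \<and> coprime g h \<and> degree g \<ge> 1 \<and> degree h \<ge> 1 \<longrightarrow>
               Phi_conv ((g, e 1) # (h, e 1) # map (\<lambda>i. (lf i, e i)) [2..<Suc r]) < Phi_conv ff) \<and>
            Phi l \<le> Phi_conv ff" if d: "\<forall>i\<in>{1..r}. d i \<ge> 1"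
  proof -
    have deg: "degree (lf i) \<ge> 1" if i: "i \<in> {1..r}" for i
    proof -
      have "degree (linearized (lf i)) = q ^ d i"
        using assms(8) Lf i by simp
      moreover from this have "lf i \<noteq> 0"
        using q by (auto dest: sym)
      ultimately have "d i = degree (lf i)"
        using degree_linearized[of "lf i"] q by (simp flip: assms(1))
      with d i show ?thesis
        by metis
    qed
    \<comment> \<open>The empty product is 1, of degree 0, whereas \<open>l\<close> has degree
      \<open>n \<ge> 1\<close>.\<close>
    have "r \<ge> 1"
      using deg_l assms(2) l by (cases r) (auto simp: assms(14) conv_prod_def)
    hence ff: "ff = (lf 1, e 1) # map (\<lambda>i. (lf i, e i)) [2..<Suc r]"
      unfolding assms(14) by (simp add: upt_conv_Cons numeral_2_eq_2 del: upt_Suc)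
    have "Phi l \<le> Phi_conv ff"
      unfolding l by (rule Phi_le_Phi_conv) (use assms(7) deg in \<open>auto simp: assms(14)\<close>)
    moreover have "Phi_conv ((g, e 1) # (h, e 1) # map (\<lambda>i. (lf i, e i)) [2..<Suc r]) < Phi_conv ff"
      if gh: "lf 1 = g * h" "degree g \<ge> 1" "degree h \<ge> 1" for g h
      unfolding ff gh(1)
    proof (rule Phi_conv_refine_less)
      show "conv_prod ((g * h, e 1) # map (\<lambda>i. (lf i, e i)) [2..<Suc r]) \<noteq> 0"
        using l0 by (simp only: l ff gh(1) not_False_eq_True)
      show "degree p \<ge> 1 \<and> coprime (g * h) p" if "(p, j) \<in> set (map (\<lambda>i. (lf i, e i)) [2..<Suc r])" for p j
        using that deg assms(10) \<open>r \<ge> 1\<close> by (auto simp flip: gh(1))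
    qed (use gh assms(7) \<open>r \<ge> 1\<close> in auto)
    ultimately show ?thesis
      by blast
  qed
  ultimately show ?thesis
    using l by blast
qed

end
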